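(* Let $\Omega$ be a locally compact Hausdorff space with infinite cardinality, and let $K$ be the pseudocone of all scalar multiples of positive Radon measures on $\Omega$, i.e. $K=\{\lambda\mu:\ \lambda\in\mathbb{C},\ \mu\in M_+(\Omega)\}$. Then $M(\Omega)\setminus K$ is spaceable in $M(\Omega)$. Consequently, the complement $M(\Omega)\setminus M_+(\Omega)$ of the cone of all positive Radon measures on $\Omega$ is spaceable in $M(\Omega)$.
   Context: $M(\Omega)$ is the Banach space of complex Radon measures on $\Omega$ with the total variation norm, and $M_+(\Omega)\subseteq M(\Omega)$ is the set of all non-negative Radon measures in $M(\Omega)$. A subset $B$ of a vector space is a pseudocone if $cB\subseteq B$ for each scalar $c$. A subset $S$ of a Banach space $Y$ is spaceable in $Y$ if $S\cup\{0\}$ contains a closed infinite-dimensional linear subspace of $Y$. *)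

theory Defs
  imports "HOL-Analysis.Analysis" "HOL-Library.Function_Algebras"
begin

section \<open>Spaceability in a normed space given by a carrier\<close>

text \<open>
  A normed space is given by a scalar multiplication on an ambient abelian group, a carrier
  \<open>Y\<close> (a linear subspace of the ambient group) and a norm \<open>N\<close>, only relevant on \<open>Y\<close>.
  Closedness refers to the topology of the metric \<open>N (x - y)\<close> on \<open>Y\<close>.
\<close>

definition norm_topology :: "'b::ab_group_add set \<Rightarrow> ('b \<Rightarrow> real) \<Rightarrow> 'b topology" where
  "norm_topology Y N = Metric_space.mtopology Y (\<lambda>x y. N (x - y))"

definition spaceable ::
  "('k::field \<Rightarrow> 'b::ab_group_add \<Rightarrow> 'b) \<Rightarrow> 'b set \<Rightarrow> ('b \<Rightarrow> real) \<Rightarrow> 'b set \<Rightarrow> bool" where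
  "spaceable scl Y N S \<longleftrightarrow>
     (\<exists>V. V \<subseteq> S \<union> {0}
        \<and> module.subspace scl V
        \<and> \<not> (\<exists>B. finite B \<and> module.span scl B = V)
        \<and> closedin (norm_topology Y N) V)"

definition pseudocone :: "('k::field \<Rightarrow> 'b::ab_group_add \<Rightarrow> 'b) \<Rightarrow> 'b set \<Rightarrow> bool" where
  "pseudocone scl B \<longleftrightarrow> (\<forall>c. scl c ` B \<subseteq> B)"

section \<open>Complex Radon measures\<close>

definition borel_sets :: "'a topology \<Rightarrow> 'a set set" where
  "borel_sets X = sigma_sets (topspace X) {U. openin X U}"

text \<open>
  A set function is defined on all sets; it is required to vanish off the Borel sets, so that
  equality of measures is equality of functions.  Countable additivity implies \<open>\<mu> {} = 0\<close>.
\<close>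

definition complex_borel_measure :: "'a topology \<Rightarrow> ('a set \<Rightarrow> complex) \<Rightarrow> bool" where
  "complex_borel_measure X \<mu> \<longleftrightarrow>
     (\<forall>E. E \<notin> borel_sets X \<longrightarrow> \<mu> E = 0) \<and>
     (\<forall>A :: nat \<Rightarrow> 'a set. range A \<subseteq> borel_sets X \<longrightarrow> disjoint_family A \<longrightarrow>
        (\<lambda>i. \<mu> (A i)) sums \<mu> (\<Union>i. A i))"

definition variation :: "'a topology \<Rightarrow> ('a set \<Rightarrow> complex) \<Rightarrow> 'a set \<Rightarrow> ennreal" where
  "variation X \<mu> E =
     (SUP P \<in> {P :: nat \<Rightarrow> 'a set. range P \<subseteq> borel_sets X \<and> disjoint_family P \<and> (\<Union>i. P i) = E}.
        \<Sum>i. ennreal (cmod (\<mu> (P i))))"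

definition tv_norm :: "'a topology \<Rightarrow> ('a set \<Rightarrow> complex) \<Rightarrow> real" where
  "tv_norm X \<mu> = enn2real (variation X \<mu> (topspace X))"

text \<open>
  A complex measure is Radon if its variation is a finite Radon measure; for finite measures
  this is outer regularity by open sets and inner regularity by compact sets on all Borel sets.
  Finiteness is automatic for a complex measure; it is listed because \<open>tv_norm\<close> would otherwise read an infinite variation as \<open>0\<close>.
\<close>

definition radon_measures :: "'a topology \<Rightarrow> ('a set \<Rightarrow> complex) set" where
  "radon_measures X = {\<mu>. complex_borel_measure X \<mu> \<and>
     variation X \<mu> (topspace X) < \<infinity> \<and>
     (\<forall>E \<in> borel_sets X.
        variation X \<mu> E = (INF U \<in> {U. openin X U \<and> E \<subseteq> U}. variation X \<mu> U) \<and>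
        variation X \<mu> E = (SUP C \<in> {C. compactin X C \<and> C \<subseteq> E}. variation X \<mu> C))}"

definition positive_radon_measures :: "'a topology \<Rightarrow> ('a set \<Rightarrow> complex) set" where
  "positive_radon_measures X =
     {\<mu> \<in> radon_measures X. \<forall>E \<in> borel_sets X. \<mu> E \<in> \<real>\<^sub>\<ge>\<^sub>0}"

definition scale_measure_c :: "complex \<Rightarrow> ('a set \<Rightarrow> complex) \<Rightarrow> 'a set \<Rightarrow> complex" where
  "scale_measure_c c \<mu> = (\<lambda>E. c * \<mu> E)"

global_interpretation cmeas: vector_space scale_measure_c
  by standard (auto simp: scale_measure_c_def fun_eq_iff algebra_simps)

definition multiples_of_positive :: "'a topology \<Rightarrow> ('a set \<Rightarrow> complex) set" where
  "multiples_of_positive X =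
     {scale_measure_c c \<mu> | c \<mu>. \<mu> \<in> positive_radon_measures X}"

lemma pseudocone_multiples_of_positive:
  "pseudocone scale_measure_c (multiples_of_positive X)"
  unfolding pseudocone_def multiples_of_positive_def
  by (auto simp: cmeas.scale_scale) blast

section \<open>The carrier is a normed space\<close>

lemma borel_sets_subset: "E \<in> borel_sets X \<Longrightarrow> E \<subseteq> topspace X"
  unfolding borel_sets_def by (rule sigma_sets_into_sp) (auto dest: openin_subset)

lemma sigma_algebra_borel_sets: "sigma_algebra (topspace X) (borel_sets X)"
  unfolding borel_sets_def by (rule sigma_algebra_sigma_sets) (auto dest: openin_subset)

lemma borel_sets_Un: "A \<in> borel_sets X \<Longrightarrow> B \<in> borel_sets X \<Longrightarrow> A \<union> B \<in> borel_sets X"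
  and borel_sets_Int: "A \<in> borel_sets X \<Longrightarrow> B \<in> borel_sets X \<Longrightarrow> A \<inter> B \<in> borel_sets X"
  and borel_sets_Diff: "A \<in> borel_sets X \<Longrightarrow> B \<in> borel_sets X \<Longrightarrow> A - B \<in> borel_sets X"
  and borel_sets_empty: "{} \<in> borel_sets X"
  and borel_sets_top: "topspace X \<in> borel_sets X"
proof -
  interpret sigma_algebra "topspace X" "borel_sets X" by (rule sigma_algebra_borel_sets)
  show "A \<in> borel_sets X \<Longrightarrow> B \<in> borel_sets X \<Longrightarrow> A \<union> B \<in> borel_sets X"
    "A \<in> borel_sets X \<Longrightarrow> B \<in> borel_sets X \<Longrightarrow> A \<inter> B \<in> borel_sets X"
    "A \<in> borel_sets X \<Longrightarrow> B \<in> borel_sets X \<Longrightarrow> A - B \<in> borel_sets X"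
    "{} \<in> borel_sets X" "topspace X \<in> borel_sets X"
    by auto
qed

lemma borel_sets_open: "openin X U \<Longrightarrow> U \<in> borel_sets X"
  unfolding borel_sets_def by auto

lemma borel_sets_compact:
  assumes "Hausdorff_space X" "compactin X C"
  shows "C \<in> borel_sets X"
proof -
  have "closedin X C" using assms by (rule compactin_imp_closedin)
  then have "C = topspace X - (topspace X - C)" "openin X (topspace X - C)"
    by (auto simp: closedin_def)
  then show ?thesis by (metis borel_sets_Diff borel_sets_open borel_sets_top)
qed

lemma complex_borel_measure_empty:
  assumes "complex_borel_measure X \<mu>"
  shows "\<mu> {} = 0"
proof -
  have "(\<lambda>i::nat. \<mu> {}) sums \<mu> (\<Union>i::nat. {})"
    using assms borel_sets_empty[of X]
    by (auto simp: complex_borel_measure_def disjoint_family_on_def dest!: spec[of _ "\<lambda>i. {}"])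
  then show ?thesis by (simp add: sums_iff summable_const_iff)
qed

lemma complex_borel_measure_Un:
  assumes \<mu>: "complex_borel_measure X \<mu>"
    and A: "A \<in> borel_sets X" and B: "B \<in> borel_sets X" and AB: "A \<inter> B = {}"
  shows "\<mu> (A \<union> B) = \<mu> A + \<mu> B"
proof -
  have "(\<lambda>i. \<mu> (binaryset A B i)) sums \<mu> (\<Union>i. binaryset A B i)"
  proof -
    have "range (binaryset A B) \<subseteq> borel_sets X"
      using A B borel_sets_empty[of X] by (auto simp: range_binaryset_eq)
    moreover have "disjoint_family (binaryset A B)"
      using AB by (auto simp: disjoint_family_on_def binaryset_def)
    ultimately show ?thesis
      using \<mu> by (auto simp: complex_borel_measure_def)
  qed
  then have "(\<lambda>i. \<mu> (binaryset A B i)) sums \<mu> (A \<union> B)"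
    by (simp add: UN_binaryset_eq)
  moreover have "(\<lambda>i. \<mu> (binaryset A B i)) sums (\<mu> A + \<mu> B)"
    by (rule binaryset_sums) (rule complex_borel_measure_empty[OF \<mu>])
  ultimately show ?thesis by (rule sums_unique2)
qed

lemma variation_ge:
  assumes "range P \<subseteq> borel_sets X" "disjoint_family P" "(\<Union>i. P i) = E"
  shows "(\<Sum>i. ennreal (cmod (\<mu> (P i)))) \<le> variation X \<mu> E"
  unfolding variation_def by (rule SUP_upper) (use assms in auto)

lemma variation_ge_cmod:
  assumes \<mu>: "complex_borel_measure X \<mu>" and E: "E \<in> borel_sets X"
  shows "ennreal (cmod (\<mu> E)) \<le> variation X \<mu> E"
proof -
  define P where "P = (\<lambda>i::nat. if i = 0 then E else {})"
  have "(\<Sum>i. ennreal (cmod (\<mu> (P i)))) = (\<Sum>i\<in>{0}. ennreal (cmod (\<mu> (P i))))"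
    by (rule suminf_finite) (auto simp: P_def complex_borel_measure_empty[OF \<mu>])
  moreover have "(\<Sum>i. ennreal (cmod (\<mu> (P i)))) \<le> variation X \<mu> E"
    by (rule variation_ge)
      (use E borel_sets_empty[of X] in \<open>auto simp: P_def disjoint_family_on_def split: if_splits\<close>)
  ultimately show ?thesis by (simp add: P_def)
qed

lemma variation_superadd:
  assumes A: "A \<in> borel_sets X" and B: "B \<in> borel_sets X" and AB: "A \<inter> B = {}"
  shows "variation X \<mu> A + variation X \<mu> B \<le> variation X \<mu> (A \<union> B)"
proof -
  let ?\<P> = "\<lambda>E. {P :: nat \<Rightarrow> 'a set. range P \<subseteq> borel_sets X \<and> disjoint_family P \<and> (\<Union>i. P i) = E}"
  let ?s = "\<lambda>P. \<Sum>i. ennreal (cmod (\<mu> (P i)))"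
  have 1: "?s P + ?s Q \<le> variation X \<mu> (A \<union> B)" if P: "P \<in> ?\<P> A" and Q: "Q \<in> ?\<P> B" for P Q
  proof -
    define R where "R = (\<lambda>i. if even i then P (i div 2) else Q (i div 2))"
    have PA: "P i \<subseteq> A" "Q i \<subseteq> B" for i using P Q by auto
    have PP: "P i \<inter> P j = {}" "Q i \<inter> Q j = {}" if "i \<noteq> j" for i j
      using P Q that by (auto simp: disjoint_family_on_def)
    have "range R \<subseteq> borel_sets X" using P Q by (auto simp: R_def)
    moreover have "disjoint_family R"
      unfolding disjoint_family_on_def
    proof (intro ballI impI)
      fix m n :: nat assume mn: "m \<noteq> n"
      show "R m \<inter> R n = {}"
      proof (cases "even m = even n")
        case True
        then have "m div 2 \<noteq> n div 2" using mn by presburger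
        then show ?thesis using True PP by (simp add: R_def)
      next
        case False
        then show ?thesis using PA[of "m div 2"] PA[of "n div 2"] AB by (auto simp: R_def)
      qed
    qed
    moreover have "(\<Union>i. R i) = A \<union> B"
    proof -
      have "A = (\<Union>i. R (2 * i))" "B = (\<Union>i. R (2 * i + 1))" using P Q by (auto simp: R_def)
      then have "A \<union> B \<subseteq> (\<Union>i. R i)" by blast
      moreover have "(\<Union>i. R i) \<subseteq> A \<union> B" using PA by (auto simp: R_def split: if_splits)
      ultimately show ?thesis by blast
    qed
    ultimately have R: "?s R \<le> variation X \<mu> (A \<union> B)" by (rule variation_ge)
    let ?f = "\<lambda>R i. ennreal (cmod (\<mu> (R i)))"
    have fin: "(\<Sum>i<n. ?f P i) + (\<Sum>i<n. ?f Q i) \<le> ?s R" for n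
    proof -
      have "(\<Sum>i<n. ?f P i) + (\<Sum>i<n. ?f Q i) = (\<Sum>i<2*n. ?f R i)"
        by (induction n) (auto simp: R_def algebra_simps)
      also have "\<dots> \<le> ?s R" by (rule sum_le_suminf) auto
      finally show ?thesis .
    qed
    have "(\<lambda>n. (\<Sum>i<n. ?f P i) + (\<Sum>i<n. ?f Q i)) \<longlonglongrightarrow> ?s P + ?s Q"
      by (intro tendsto_add summable_LIMSEQ) auto
    then have "?s P + ?s Q \<le> ?s R"
      by (rule LIMSEQ_le_const2) (use fin in auto)
    then show ?thesis using R by (rule order_trans)
  qed
  have ne: "?\<P> E \<noteq> {}" if "E \<in> borel_sets X" for E
  proof -
    have "(\<lambda>i::nat. if i = 0 then E else {}) \<in> ?\<P> E"
      using that borel_sets_empty[of X] by (auto simp: disjoint_family_on_def split: if_splits)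
    then show ?thesis by blast
  qed
  have "?s P + variation X \<mu> B \<le> variation X \<mu> (A \<union> B)" if P: "P \<in> ?\<P> A" for P
    unfolding variation_def[of X \<mu> B]
    by (subst ennreal_SUP_add_right[OF ne[OF B]]) (rule SUP_least, rule 1[OF P])
  then show ?thesis
    unfolding variation_def[of X \<mu> A]
    by (subst ennreal_SUP_add_left[OF ne[OF A], symmetric]) (rule SUP_least)
qed

lemma variation_mono:
  assumes "A \<in> borel_sets X" "B \<in> borel_sets X" "A \<subseteq> B"
  shows "variation X \<mu> A \<le> variation X \<mu> B"
proof -
  have "variation X \<mu> A \<le> variation X \<mu> A + variation X \<mu> (B - A)" by simp
  also have "\<dots> \<le> variation X \<mu> (A \<union> (B - A))"
    by (rule variation_superadd) (use assms borel_sets_Diff in auto)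
  finally show ?thesis using assms(3) by (simp add: Un_absorb1)
qed

lemma variation_subadd:
  assumes \<mu>: "complex_borel_measure X \<mu>"
    and A: "A \<in> borel_sets X" and B: "B \<in> borel_sets X" and AB: "A \<inter> B = {}"
  shows "variation X \<mu> (A \<union> B) \<le> variation X \<mu> A + variation X \<mu> B"
  unfolding variation_def[of X \<mu> "A \<union> B"]
proof (rule SUP_least, clarify)
  fix P :: "nat \<Rightarrow> 'a set"
  assume P: "range P \<subseteq> borel_sets X" "disjoint_family P" and E: "(\<Union>i. P i) = A \<union> B"
  have meas: "P i \<inter> A \<in> borel_sets X" "P i \<inter> B \<in> borel_sets X" for i
    using P A B borel_sets_Int by auto
  have le: "ennreal (cmod (\<mu> (P i))) \<le> ennreal (cmod (\<mu> (P i \<inter> A))) + ennreal (cmod (\<mu> (P i \<inter> B)))"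
    for i
  proof -
    have "P i = (P i \<inter> A) \<union> (P i \<inter> B)" using E by auto
    then have "\<mu> (P i) = \<mu> (P i \<inter> A) + \<mu> (P i \<inter> B)"
      using complex_borel_measure_Un[OF \<mu> meas(1)[of i] meas(2)[of i]] AB by auto
    then show ?thesis
      by (metis ennreal_leI ennreal_plus norm_ge_zero norm_triangle_ineq)
  qed
  have "(\<Sum>i. ennreal (cmod (\<mu> (P i))))
      \<le> (\<Sum>i. ennreal (cmod (\<mu> (P i \<inter> A))) + ennreal (cmod (\<mu> (P i \<inter> B))))"
    by (rule suminf_le[OF le]) auto
  also have "\<dots> = (\<Sum>i. ennreal (cmod (\<mu> (P i \<inter> A)))) + (\<Sum>i. ennreal (cmod (\<mu> (P i \<inter> B))))"
    by (rule suminf_add[symmetric]) auto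
  also have "\<dots> \<le> variation X \<mu> A + variation X \<mu> B"
  proof (intro add_mono variation_ge)
    show "disjoint_family (\<lambda>i. P i \<inter> A)" "disjoint_family (\<lambda>i. P i \<inter> B)"
      using P(2) by (fastforce simp: disjoint_family_on_def)+
  qed (use meas E in auto)
  finally show "(\<Sum>i. ennreal (cmod (\<mu> (P i)))) \<le> variation X \<mu> A + variation X \<mu> B" .
qed

lemma variation_Diff_add:
  assumes \<mu>: "complex_borel_measure X \<mu>"
    and "A \<in> borel_sets X" "B \<in> borel_sets X" "A \<subseteq> B"
  shows "variation X \<mu> B = variation X \<mu> A + variation X \<mu> (B - A)"
proof -
  have "A \<union> (B - A) = B" "A \<inter> (B - A) = {}" using assms(4) by auto
  then show ?thesis
    using variation_superadd[of A X "B - A" \<mu>] variation_subadd[OF \<mu>, of A "B - A"] assms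
      borel_sets_Diff[of B X A] by (metis antisym)
qed

lemma variation_zero: "variation X 0 E = 0"
  unfolding variation_def by (simp add: SUP_constant bot_ennreal)

lemma variation_scale:
  "variation X (scale_measure_c c \<mu>) E = ennreal (cmod c) * variation X \<mu> E"
  unfolding variation_def scale_measure_c_def
  by (simp add: norm_mult ennreal_mult SUP_mult_left_ennreal)

lemma variation_uminus: "variation X (- \<mu>) E = variation X \<mu> E"
  unfolding variation_def by simp

lemma variation_add: "variation X (\<mu> + \<nu>) E \<le> variation X \<mu> E + variation X \<nu> E"
  unfolding variation_def[of X "\<mu> + \<nu>"]
proof (rule SUP_least, clarify)
  fix P :: "nat \<Rightarrow> 'a set"
  assume P: "range P \<subseteq> borel_sets X" "disjoint_family P" and E: "E = (\<Union>i. P i)"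
  have "(\<Sum>i. ennreal (cmod ((\<mu> + \<nu>) (P i))))
      \<le> (\<Sum>i. ennreal (cmod (\<mu> (P i))) + ennreal (cmod (\<nu> (P i))))"
    by (rule suminf_le) (auto simp: norm_triangle_ineq simp flip: ennreal_plus intro!: ennreal_leI)
  also have "\<dots> = (\<Sum>i. ennreal (cmod (\<mu> (P i)))) + (\<Sum>i. ennreal (cmod (\<nu> (P i))))"
    by (rule suminf_add[symmetric]) auto
  also have "\<dots> \<le> variation X \<mu> (\<Union>i. P i) + variation X \<nu> (\<Union>i. P i)"
    by (intro add_mono variation_ge P refl)
  finally show "(\<Sum>i. ennreal (cmod ((\<mu> + \<nu>) (P i))))
      \<le> variation X \<mu> (\<Union>i. P i) + variation X \<nu> (\<Union>i. P i)" .
qed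

text \<open>The two regularity conditions in \<open>\<epsilon>\<close>-form.\<close>

lemma radon_measures_iff:
  assumes T2: "Hausdorff_space X"
  shows "\<mu> \<in> radon_measures X \<longleftrightarrow>
    complex_borel_measure X \<mu> \<and> variation X \<mu> (topspace X) < \<infinity> \<and>
    (\<forall>E \<in> borel_sets X. \<forall>e>0. \<exists>U C. openin X U \<and> compactin X C \<and> C \<subseteq> E \<and> E \<subseteq> U \<and>
       variation X \<mu> (U - C) < ennreal e)"
    (is "?L \<longleftrightarrow> ?R")
proof
  assume L: ?L
  then have \<mu>: "complex_borel_measure X \<mu>" and fin: "variation X \<mu> (topspace X) < \<infinity>"
    by (auto simp: radon_measures_def)
  have fin': "variation X \<mu> E < \<infinity>" if "E \<in> borel_sets X" for E
    using variation_mono[OF that borel_sets_top borel_sets_subset[OF that]] fin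
    by (rule le_less_trans)
  show ?R
  proof (intro conjI \<mu> fin ballI allI impI)
    fix E and e :: real assume E: "E \<in> borel_sets X" and e: "e > 0"
    let ?v = "variation X \<mu>"
    obtain r where r: "r \<ge> 0" "?v E = ennreal r"
      using fin'[OF E] by (cases "?v E") auto
    then have "?v E < ?v E + ennreal (e / 2)"
      using e by (simp add: ennreal_lessI flip: ennreal_plus)
    moreover have "?v E = (INF U \<in> {U. openin X U \<and> E \<subseteq> U}. ?v U)"
      using L E by (auto simp: radon_measures_def)
    ultimately obtain U where U: "openin X U" "E \<subseteq> U" "?v U < ?v E + ennreal (e / 2)"
      by (metis (mono_tags, lifting) INF_less_iff mem_Collect_eq)
    have nb: "?v E = (SUP C \<in> {C. compactin X C \<and> C \<subseteq> E}. ?v C)"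
      using L E by (auto simp: radon_measures_def)
    have "\<exists>C. compactin X C \<and> C \<subseteq> E \<and> ?v E < ?v C + ennreal (e / 2)"
    proof (cases "?v E = 0")
      case True
      moreover have "?v E < ?v {} + ennreal (e / 2)"
        unfolding True using e by (simp add: add_nonneg_pos)
      ultimately show ?thesis by (intro exI[of _ "{}"]) auto
    next
      case False
      then have "?v E - ennreal (e / 2) < ?v E"
        using fin'[OF E] e by (intro ennreal_between) (auto simp: zero_less_iff_neq_zero)
      then obtain C where C: "compactin X C" "C \<subseteq> E" "?v E - ennreal (e / 2) < ?v C"
        by (subst (asm) (2) nb) (auto simp: less_SUP_iff)
      have real_less: "ennreal x < ennreal y \<Longrightarrow> x < y" for x y
        by (metis ennreal_leI not_less)
      have "?v E < ?v C + ennreal (e / 2)"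
        using C(3) fin'[OF E] e
        by (cases "?v E"; cases "?v C")
          (auto simp: ennreal_minus ennreal_less_iff simp flip: ennreal_plus dest!: real_less)
      then show ?thesis using C by auto
    qed
    then obtain C where C: "compactin X C" "C \<subseteq> E" "?v E < ?v C + ennreal (e / 2)" by blast
    have b: "U \<in> borel_sets X" "C \<in> borel_sets X"
      using U C borel_sets_open borel_sets_compact[OF T2] by auto
    have "?v U = ?v C + ?v (U - C)"
      by (rule variation_Diff_add[OF \<mu>]) (use b U(2) C(2) in auto)
    moreover have "?v U < ?v C + ennreal e"
    proof -
      have "?v U < ?v E + ennreal (e / 2)" by (fact U)
      also have "\<dots> \<le> (?v C + ennreal (e / 2)) + ennreal (e / 2)"
        using C(3) by (intro add_right_mono) auto
      also have "\<dots> = ?v C + ennreal e"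
        using e by (simp add: add.assoc flip: ennreal_plus)
      finally show ?thesis .
    qed
    ultimately have "?v C + ?v (U - C) < ?v C + ennreal e" by simp
    then have "?v (U - C) < ennreal e"
      using add_left_mono[of "ennreal e" "?v (U - C)" "?v C"] by (simp flip: not_le)
    then show "\<exists>U C. openin X U \<and> compactin X C \<and> C \<subseteq> E \<and> E \<subseteq> U \<and> ?v (U - C) < ennreal e"
      using U(1,2) C(1,2) by blast
  qed
next
  assume R: ?R
  let ?v = "variation X \<mu>"
  from R have \<mu>: "complex_borel_measure X \<mu>" and fin: "?v (topspace X) < \<infinity>" by blast+
  have "?v E = (INF U \<in> {U. openin X U \<and> E \<subseteq> U}. ?v U) \<and>
      ?v E = (SUP C \<in> {C. compactin X C \<and> C \<subseteq> E}. ?v C)" if E: "E \<in> borel_sets X" for E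
  proof -
    have *: "\<exists>U C. openin X U \<and> compactin X C \<and> C \<subseteq> E \<and> E \<subseteq> U \<and>
        ?v U \<le> ?v E + ennreal e \<and> ?v E \<le> ?v C + ennreal e" if e: "e > 0" for e
    proof -
      from R E e obtain U C where UC: "openin X U" "compactin X C" "C \<subseteq> E" "E \<subseteq> U"
        and less: "?v (U - C) < ennreal e" by blast
      have b: "U \<in> borel_sets X" "C \<in> borel_sets X"
        using UC borel_sets_open borel_sets_compact[OF T2] by auto
      have "?v U = ?v E + ?v (U - E)" "?v E = ?v C + ?v (E - C)"
        by (rule variation_Diff_add[OF \<mu>]; use b E UC(3,4) in blast)+
      moreover have "?v (U - E) \<le> ?v (U - C)" "?v (E - C) \<le> ?v (U - C)"
        by (rule variation_mono; use b E UC(3,4) borel_sets_Diff in blast)+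
      ultimately have "?v U \<le> ?v E + ennreal e" "?v E \<le> ?v C + ennreal e"
        using less by (simp_all add: add_left_mono order_trans[OF _ less_imp_le[OF less]])
      then show ?thesis using UC by blast
    qed
    show ?thesis
    proof (intro conjI antisym)
      show "?v E \<le> (INF U \<in> {U. openin X U \<and> E \<subseteq> U}. ?v U)"
        by (auto intro!: INF_greatest variation_mono E borel_sets_open)
      show "(SUP C \<in> {C. compactin X C \<and> C \<subseteq> E}. ?v C) \<le> ?v E"
        by (auto intro!: SUP_least variation_mono E borel_sets_compact[OF T2])
      show "(INF U \<in> {U. openin X U \<and> E \<subseteq> U}. ?v U) \<le> ?v E"
      proof (rule ennreal_le_epsilon)
        fix e :: real assume "e > 0"
        from *[OF this] obtain U where "openin X U" "E \<subseteq> U" "?v U \<le> ?v E + ennreal e" by blast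
        then show "(INF U \<in> {U. openin X U \<and> E \<subseteq> U}. ?v U) \<le> ?v E + ennreal e"
          by (intro INF_lower2[of U]) auto
      qed
      show "?v E \<le> (SUP C \<in> {C. compactin X C \<and> C \<subseteq> E}. ?v C)"
      proof (rule ennreal_le_epsilon)
        fix e :: real assume "e > 0"
        from *[OF this] obtain C where C: "compactin X C" "C \<subseteq> E" "?v E \<le> ?v C + ennreal e"
          by blast
        have "?v C \<le> (SUP C \<in> {C. compactin X C \<and> C \<subseteq> E}. ?v C)"
          by (rule SUP_upper) (use C in auto)
        then show "?v E \<le> (SUP C \<in> {C. compactin X C \<and> C \<subseteq> E}. ?v C) + ennreal e"
          using C(3) by (meson add_right_mono order_trans)
      qed
    qed
  qed
  then show ?L
    unfolding radon_measures_def mem_Collect_eq by (intro conjI[OF \<mu> conjI[OF fin ballI]])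
qed

lemma subspace_radon_measures:
  assumes T2: "Hausdorff_space X"
  shows "cmeas.subspace (radon_measures X)"
proof (rule cmeas.subspaceI)
  have cb0: "complex_borel_measure X 0" by (simp add: complex_borel_measure_def)
  show "0 \<in> radon_measures X"
    unfolding radon_measures_iff[OF T2]
  proof (intro conjI cb0 ballI allI impI)
    fix E and e :: real assume E: "E \<in> borel_sets X" and "e > 0"
    then have "openin X (topspace X) \<and> compactin X {} \<and> {} \<subseteq> E \<and> E \<subseteq> topspace X \<and>
        variation X 0 (topspace X - {}) < ennreal e"
      using borel_sets_subset[OF E] by (simp add: variation_zero)
    then show "\<exists>U C. openin X U \<and> compactin X C \<and> C \<subseteq> E \<and> E \<subseteq> U \<and>
        variation X 0 (U - C) < ennreal e" by blast
  qed (simp add: variation_zero)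
next
  fix \<mu> \<nu> assume \<mu>: "\<mu> \<in> radon_measures X" and \<nu>: "\<nu> \<in> radon_measures X"
  have cb: "complex_borel_measure X (\<mu> + \<nu>)"
    using \<mu> \<nu> by (auto simp: radon_measures_def complex_borel_measure_def intro!: sums_add)
  show "\<mu> + \<nu> \<in> radon_measures X"
    unfolding radon_measures_iff[OF T2]
  proof (intro conjI cb ballI allI impI)
    have "variation X \<mu> (topspace X) + variation X \<nu> (topspace X) < \<infinity>"
      using \<mu> \<nu> by (simp add: radon_measures_def)
    then show "variation X (\<mu> + \<nu>) (topspace X) < \<infinity>"
      using variation_add by (rule le_less_trans[rotated])
    fix E and e :: real assume E: "E \<in> borel_sets X" and "e > 0"
    then have e2: "e / 2 > 0" by simp
    obtain U C where 1: "openin X U" "compactin X C" "C \<subseteq> E" "E \<subseteq> U"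
        "variation X \<mu> (U - C) < ennreal (e / 2)"
      using \<mu> E e2 unfolding radon_measures_iff[OF T2] by blast
    obtain U' C' where 2: "openin X U'" "compactin X C'" "C' \<subseteq> E" "E \<subseteq> U'"
        "variation X \<nu> (U' - C') < ennreal (e / 2)"
      using \<nu> E e2 unfolding radon_measures_iff[OF T2] by blast
    let ?U = "U \<inter> U'" and ?C = "C \<union> C'"
    have oc: "openin X ?U" "compactin X ?C" using 1 2 by (auto intro: compactin_Un)
    have b: "?U - ?C \<in> borel_sets X" "U - C \<in> borel_sets X" "U' - C' \<in> borel_sets X"
      using oc 1 2 borel_sets_open borel_sets_compact[OF T2] borel_sets_Diff by metis+
    have "variation X (\<mu> + \<nu>) (?U - ?C) \<le> variation X \<mu> (?U - ?C) + variation X \<nu> (?U - ?C)"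
      by (rule variation_add)
    also have "\<dots> \<le> variation X \<mu> (U - C) + variation X \<nu> (U' - C')"
      by (intro add_mono variation_mono b) auto
    also have "\<dots> < ennreal (e / 2) + ennreal (e / 2)"
      using 1 2 by (intro add_strict_mono)
    also have "\<dots> = ennreal e" using \<open>e > 0\<close> by (simp flip: ennreal_plus)
    finally show "\<exists>U C. openin X U \<and> compactin X C \<and> C \<subseteq> E \<and> E \<subseteq> U \<and>
        variation X (\<mu> + \<nu>) (U - C) < ennreal e"
      using oc 1 2 by (intro exI[of _ ?U] exI[of _ ?C]) auto
  qed
next
  fix c \<mu> assume \<mu>: "\<mu> \<in> radon_measures X"
  have cb: "complex_borel_measure X (scale_measure_c c \<mu>)"
    using \<mu> by (auto simp: radon_measures_def complex_borel_measure_def scale_measure_c_def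
        intro!: sums_mult)
  show "scale_measure_c c \<mu> \<in> radon_measures X"
    unfolding radon_measures_iff[OF T2]
  proof (intro conjI cb ballI allI impI)
    show "variation X (scale_measure_c c \<mu>) (topspace X) < \<infinity>"
      using \<mu> by (simp add: radon_measures_def variation_scale ennreal_mult_less_top)
    fix E and e :: real assume E: "E \<in> borel_sets X" and e: "e > 0"
    have e': "e / (cmod c + 1) > 0" using e by (simp add: add_nonneg_pos)
    obtain U C where 1: "openin X U" "compactin X C" "C \<subseteq> E" "E \<subseteq> U"
        "variation X \<mu> (U - C) < ennreal (e / (cmod c + 1))"
      using \<mu> E e' unfolding radon_measures_iff[OF T2] by blast
    have "variation X (scale_measure_c c \<mu>) (U - C)
        \<le> ennreal (cmod c) * ennreal (e / (cmod c + 1))"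
      unfolding variation_scale using 1(5) by (intro mult_left_mono) auto
    also have "\<dots> = ennreal (cmod c * (e / (cmod c + 1)))"
      using e' by (intro ennreal_mult[symmetric]) auto
    also have "\<dots> < ennreal e"
      using e add_nonneg_pos[of "cmod c" 1] by (intro ennreal_lessI) (auto simp: divide_less_eq algebra_simps)
    finally show "\<exists>U C. openin X U \<and> compactin X C \<and> C \<subseteq> E \<and> E \<subseteq> U \<and>
        variation X (scale_measure_c c \<mu>) (U - C) < ennreal e"
      using 1 by blast
  qed
qed

lemma tv_norm_scale: "tv_norm X (scale_measure_c c \<mu>) = cmod c * tv_norm X \<mu>"
  by (simp add: tv_norm_def variation_scale enn2real_mult)

lemma tv_norm_triangle:
  assumes "\<mu> \<in> radon_measures X" "\<nu> \<in> radon_measures X"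
  shows "tv_norm X (\<mu> + \<nu>) \<le> tv_norm X \<mu> + tv_norm X \<nu>"
proof -
  let ?a = "variation X \<mu> (topspace X)" and ?b = "variation X \<nu> (topspace X)"
  have fin: "?a < top" "?b < top" using assms by (auto simp: radon_measures_def)
  have "enn2real (variation X (\<mu> + \<nu>) (topspace X)) \<le> enn2real (?a + ?b)"
    using fin by (intro enn2real_mono variation_add) auto
  then show ?thesis using fin by (simp add: tv_norm_def enn2real_plus)
qed

lemma cmod_le_tv_norm:
  assumes "\<mu> \<in> radon_measures X"
  shows "cmod (\<mu> E) \<le> tv_norm X \<mu>"
proof (cases "E \<in> borel_sets X")
  case True
  have \<mu>: "complex_borel_measure X \<mu>" and fin: "variation X \<mu> (topspace X) < top"
    using assms by (auto simp: radon_measures_def)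
  have "ennreal (cmod (\<mu> E)) \<le> variation X \<mu> (topspace X)"
    using variation_ge_cmod[OF \<mu> True]
      variation_mono[OF True borel_sets_top borel_sets_subset[OF True]] by (rule order_trans)
  then show ?thesis
    using fin unfolding tv_norm_def by (metis enn2real_ennreal enn2real_mono norm_ge_zero)
next
  case False
  then show ?thesis
    using assms by (simp add: radon_measures_def complex_borel_measure_def tv_norm_def)
qed

lemma Metric_space_radon_measures:
  assumes T2: "Hausdorff_space X"
  shows "Metric_space (radon_measures X) (\<lambda>\<mu> \<nu>. tv_norm X (\<mu> - \<nu>))"
proof
  fix \<mu> \<nu> \<rho> :: "'a set \<Rightarrow> complex"
  show "0 \<le> tv_norm X (\<mu> - \<nu>)" by (simp add: tv_norm_def)
  show "tv_norm X (\<mu> - \<nu>) = tv_norm X (\<nu> - \<mu>)"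
    unfolding tv_norm_def by (metis minus_diff_eq variation_uminus)
  assume \<mu>: "\<mu> \<in> radon_measures X" and \<nu>: "\<nu> \<in> radon_measures X"
  have d: "\<mu> - \<nu> \<in> radon_measures X"
    using cmeas.subspace_diff[OF subspace_radon_measures[OF T2] \<mu> \<nu>] .
  show "tv_norm X (\<mu> - \<nu>) = 0 \<longleftrightarrow> \<mu> = \<nu>"
  proof
    assume "tv_norm X (\<mu> - \<nu>) = 0"
    then show "\<mu> = \<nu>" using cmod_le_tv_norm[OF d] by (auto simp: fun_eq_iff)
  next
    assume "\<mu> = \<nu>"
    then show "tv_norm X (\<mu> - \<nu>) = 0" by (simp add: tv_norm_def variation_zero)
  qed
  assume \<rho>: "\<rho> \<in> radon_measures X"
  have "\<nu> - \<rho> \<in> radon_measures X"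
    using cmeas.subspace_diff[OF subspace_radon_measures[OF T2] \<nu> \<rho>] .
  from tv_norm_triangle[OF d this]
  show "tv_norm X (\<mu> - \<rho>) \<le> tv_norm X (\<mu> - \<nu>) + tv_norm X (\<nu> - \<rho>)" by simp
qed

end

(* The Radon measures of total mass zero form the kernel of the functional that maps mu to
   mu (topspace X), which is bounded for the total variation norm; hence they are a closed
   subspace. A scalar multiple of a positive measure with total mass zero vanishes, and the
   differences of Dirac measures at infinitely many points span an infinite-dimensional space. *)
theory Submission
  imports Defs
begin

text \<open>The value 0 off the Borel sets is the normalization that
  \<open>complex_borel_measure\<close> demands.\<close>

definition dirac :: "'a topology \<Rightarrow> 'a \<Rightarrow> 'a set \<Rightarrow> complex" where
  "dirac X x = (\<lambda>E. if E \<in> borel_sets X then indicator E x else 0)"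

text \<open>By disjointness at most one \<open>A n\<close> contains \<open>x\<close>, so the series
  has at most one nonzero term.\<close>

lemma complex_borel_measure_dirac: "complex_borel_measure X (dirac X x)"
  unfolding complex_borel_measure_def
proof (intro conjI allI impI)
  interpret sigma_algebra "topspace X" "borel_sets X" by (rule sigma_algebra_borel_sets)
  fix A :: "nat \<Rightarrow> 'a set" assume A: "range A \<subseteq> borel_sets X" "disjoint_family A"
  have "(\<lambda>i. indicator (A i) x :: complex) sums indicator (\<Union>i. A i) x"
  proof (cases "x \<in> (\<Union>i. A i)")
    case True
    then obtain n where "x \<in> A n" by blast
    then have "(\<lambda>i. indicator (A i) x) = (\<lambda>i. if i = n then 1 else 0 :: complex)"
      using A(2) by (auto simp: fun_eq_iff disjoint_family_on_def indicator_def)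
    then show ?thesis using True sums_single[of n "\<lambda>_. 1 :: complex"] by simp
  next
    case False
    then show ?thesis by simp
  qed
  then show "(\<lambda>i. dirac X x (A i)) sums dirac X x (\<Union>i. A i)"
    using A(1) countable_UN[of A UNIV] by (simp add: dirac_def range_subsetD)
qed (simp add: dirac_def)

text \<open>Over a Borel partition of \<open>E\<close> the indicators at \<open>x\<close> add up to
  that of \<open>E\<close>. In particular, sets missing \<open>x\<close> have variation 0, which
  drives the regularity proof below.\<close>

lemma variation_dirac_le: "variation X (dirac X x) E \<le> indicator E x"
  unfolding variation_def
proof (rule SUP_least, clarify)
  fix P :: "nat \<Rightarrow> 'a set" assume P: "range P \<subseteq> borel_sets X" "disjoint_family P"
  have "ennreal (cmod (dirac X x (P i))) = indicator (P i) x" for i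
    using P(1) by (auto simp: dirac_def indicator_def)
  then show "(\<Sum>i. ennreal (cmod (dirac X x (P i)))) \<le> indicator (\<Union>i. P i) x"
    using suminf_indicator[OF P(2), of x] by simp
qed

lemma dirac_radon:
  assumes T2: "Hausdorff_space X" and x: "x \<in> topspace X"
  shows "dirac X x \<in> radon_measures X"
  unfolding radon_measures_iff[OF T2]
proof (intro conjI ballI allI impI complex_borel_measure_dirac)
  show "variation X (dirac X x) (topspace X) < \<infinity>"
    using variation_dirac_le[of X x "topspace X"] x by (auto intro: le_less_trans)
  fix E and e :: real assume E: "E \<in> borel_sets X" and e: "e > 0"
  have cx: "compactin X {x}" using x by simp
  then have "openin X (topspace X - {x})"
    using T2 compactin_imp_closedin openin_diff openin_topspace by blast
  moreover have "variation X (dirac X x) F < ennreal e" if "x \<notin> F" for F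
    using variation_dirac_le[of X x F] that e by (simp add: zero_less_iff_neq_zero)
  ultimately have "openin X (topspace X - {x})"
    "\<And>F. x \<notin> F \<Longrightarrow> variation X (dirac X x) F < ennreal e" by blast+
  note * = this cx borel_sets_subset[OF E]
  show "\<exists>U C. openin X U \<and> compactin X C \<and> C \<subseteq> E \<and> E \<subseteq> U \<and>
      variation X (dirac X x) (U - C) < ennreal e"
  \<comment> \<open>It suffices that \<open>U - C\<close> misses \<open>x\<close>: if
    \<open>x\<close> lies in \<open>E\<close>, put it into \<open>C\<close>; otherwise remove it
    from \<open>U\<close>, which stays open because points are closed.\<close>
  proof (cases "x \<in> E")
    case True
    then show ?thesis using * by (intro exI[of _ "topspace X"] exI[of _ "{x}"]) auto
  next
    case False
    then show ?thesis using * by (intro exI[of _ "topspace X - {x}"] exI[of _ "{}"]) auto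
  qed
qed

definition null_mass_measures :: "'a topology \<Rightarrow> ('a set \<Rightarrow> complex) set" where
  "null_mass_measures X = {\<mu> \<in> radon_measures X. \<mu> (topspace X) = 0}"

lemma subspace_null_mass_measures:
  assumes "Hausdorff_space X"
  shows "cmeas.subspace (null_mass_measures X)"
  using subspace_radon_measures[OF assms]
  by (auto simp: null_mass_measures_def cmeas.subspace_def scale_measure_c_def)

text \<open>Evaluation at the whole space is bounded by \<open>tv_norm\<close>, so a measure of mass
  \<open>m\<close> has distance at least \<open>cmod m\<close> from every measure of mass
  zero.\<close>

lemma closedin_null_mass_measures:
  assumes T2: "Hausdorff_space X"
  shows "closedin (norm_topology (radon_measures X) (tv_norm X)) (null_mass_measures X)"
proof -
  interpret Metric_space "radon_measures X" "\<lambda>\<mu> \<nu>. tv_norm X (\<mu> - \<nu>)"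
    by (rule Metric_space_radon_measures[OF T2])
  show ?thesis
    unfolding norm_topology_def closedin_metric
  proof (intro conjI allI impI)
    fix \<mu> assume "\<mu> \<in> radon_measures X - null_mass_measures X"
    then have \<mu>: "\<mu> \<in> radon_measures X" "\<mu> (topspace X) \<noteq> 0"
      by (auto simp: null_mass_measures_def)
    have "\<nu> \<notin> mball \<mu> (cmod (\<mu> (topspace X)))" if "\<nu> \<in> null_mass_measures X" for \<nu>
    proof -
      have "\<mu> - \<nu> \<in> radon_measures X" "\<nu> (topspace X) = 0"
        using cmeas.subspace_diff[OF subspace_radon_measures[OF T2]] \<mu> that
        by (auto simp: null_mass_measures_def)
      then show ?thesis using cmod_le_tv_norm[of "\<mu> - \<nu>" X "topspace X"] by simp
    qed
    then show "\<exists>r>0. disjnt (null_mass_measures X) (mball \<mu> r)"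
      using \<mu>(2) by (intro exI[of _ "cmod (\<mu> (topspace X))"]) (auto simp: disjnt_def)
  qed (auto simp: null_mass_measures_def)
qed

lemma positive_radon_measures_eq_0:
  assumes \<mu>: "\<mu> \<in> positive_radon_measures X" and 0: "\<mu> (topspace X) = 0"
  shows "\<mu> = 0"
proof
  fix E
  have cb: "complex_borel_measure X \<mu>"
    \<comment> \<open>The order on complex numbers is componentwise, so this says real and
      nonnegative, and a vanishing sum of two such values forces both to vanish.\<close>
    and pos: "\<And>F. F \<in> borel_sets X \<Longrightarrow> \<mu> F \<ge> 0"
    using \<mu> by (auto simp: positive_radon_measures_def radon_measures_def
        nonneg_Reals_def less_eq_complex_def)
  show "\<mu> E = 0 E"
  proof (cases "E \<in> borel_sets X")
    case True
    then have c: "topspace X - E \<in> borel_sets X" by (simp add: borel_sets_Diff borel_sets_top)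
    have "\<mu> E + \<mu> (topspace X - E) = 0"
      using complex_borel_measure_Un[OF cb True c] borel_sets_subset[OF True] 0
      by (simp add: Un_absorb1)
    then show ?thesis using pos[OF True] pos[OF c] by (simp add: add_nonneg_eq_0_iff)
  next
    case False
    then show ?thesis using cb by (simp add: complex_borel_measure_def)
  qed
qed

text \<open>The mass of \<open>scale_measure_c c \<nu>\<close> is \<open>c\<close> times that of
  \<open>\<nu>\<close>, so one of these two factors is zero.\<close>

lemma null_mass_Int_multiples:
  assumes "\<mu> \<in> null_mass_measures X" "\<mu> \<in> multiples_of_positive X"
  shows "\<mu> = 0"
proof -
  obtain c \<nu> where \<nu>: "\<mu> = scale_measure_c c \<nu>" "\<nu> \<in> positive_radon_measures X"
    using assms(2) by (auto simp: multiples_of_positive_def)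
  then have "c = 0 \<or> \<nu> (topspace X) = 0"
    using assms(1) by (auto simp: null_mass_measures_def scale_measure_c_def)
  then show ?thesis
    using \<nu> positive_radon_measures_eq_0 by fastforce
qed

lemma null_mass_measures_infinite_dim:
  assumes T2: "Hausdorff_space X" and inf: "infinite (topspace X)"
    and B: "finite B"
  shows "cmeas.span B \<noteq> null_mass_measures X"
proof
  assume span: "cmeas.span B = null_mass_measures X"
  obtain p where p: "p \<in> topspace X" using inf by fastforce
  let ?d = "\<lambda>x. dirac X x - dirac X p"
  let ?T = "topspace X - {p}"
  have sing: "{x} \<in> borel_sets X" if "x \<in> topspace X" for x
    using that by (simp add: borel_sets_compact[OF T2])
  \<comment> \<open>Evaluations at the singletons \<open>{y}\<close> with \<open>y\<close> distinct
    from the base point \<open>p\<close> are dual to the differences \<open>?d x\<close>; this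
    yields both injectivity and independence.\<close>
  have d: "?d x {y} = (if x = y then 1 else 0)" if "y \<in> ?T" for x y
    using that sing by (auto simp: dirac_def)
  have inj: "inj_on ?d ?T"
    by (rule inj_onI) (metis d one_neq_zero)
  have "cmeas.independent (?d ` ?T)"
    unfolding cmeas.dependent_def
  proof
    assume "\<exists>a\<in>?d ` ?T. a \<in> cmeas.span (?d ` ?T - {a})"
    then obtain y where y: "y \<in> ?T" and dep: "?d y \<in> cmeas.span (?d ` ?T - {?d y})"
      by blast
    \<comment> \<open>The kernel of evaluation at \<open>{y}\<close> contains every other
      difference, hence their span, but not \<open>?d y\<close>.\<close>
    have "cmeas.subspace {\<mu>. \<mu> {y} = 0}"
      by (auto simp: cmeas.subspace_def scale_measure_c_def)
    moreover have "?d ` ?T - {?d y} \<subseteq> {\<mu>. \<mu> {y} = 0}"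
      using d[of y] y by auto
    ultimately have "?d y {y} = 0"
      using cmeas.span_minimal dep by blast
    then show False using d[of y y] y by simp
  qed
  \<comment> \<open>Both Dirac measures have mass 1, so each difference has mass zero.\<close>
  moreover have "?d ` ?T \<subseteq> cmeas.span B"
    using p dirac_radon[OF T2] cmeas.subspace_diff[OF subspace_radon_measures[OF T2]]
    unfolding span null_mass_measures_def
    by (auto simp: dirac_def borel_sets_top)
  ultimately have "finite (?d ` ?T)"
    using cmeas.independent_span_bound[OF B] by blast
  then show False using inj inf by (simp add: finite_image_iff)
qed

lemma spaceable_mono:
  assumes "spaceable scl Y N S" "S \<subseteq> T"
  shows "spaceable scl Y N T"
  using assms unfolding spaceable_def by (meson Un_mono order_refl order_trans)

theorem corollary5p5:
  fixes X :: "'a topology"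
  assumes "locally_compact_space X"
    and "Hausdorff_space X"
    and "infinite (topspace X)"
  shows "spaceable scale_measure_c (radon_measures X) (tv_norm X)
           (radon_measures X - multiples_of_positive X)
    \<and> spaceable scale_measure_c (radon_measures X) (tv_norm X)
           (radon_measures X - positive_radon_measures X)"
proof -
  have "null_mass_measures X \<subseteq> (radon_measures X - multiples_of_positive X) \<union> {0}"
    using null_mass_Int_multiples by (auto simp: null_mass_measures_def)
  then have *: "spaceable scale_measure_c (radon_measures X) (tv_norm X)
      (radon_measures X - multiples_of_positive X)"
    unfolding spaceable_def
    using subspace_null_mass_measures[OF assms(2)] closedin_null_mass_measures[OF assms(2)]
      null_mass_measures_infinite_dim[OF assms(2,3)]
    by (intro exI[of _ "null_mass_measures X"]) auto
  \<comment> \<open>Every positive measure is its own multiple by 1, so the second complement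
    contains the first.\<close>
  have "\<mu> \<in> multiples_of_positive X" if "\<mu> \<in> positive_radon_measures X" for \<mu>
    using that cmeas.scale_one[of \<mu>] unfolding multiples_of_positive_def
    by (metis (mono_tags, lifting) mem_Collect_eq)
  then have "radon_measures X - multiples_of_positive X
      \<subseteq> radon_measures X - positive_radon_measures X" by blast
  with * show ?thesis using spaceable_mono by blast
qed

end
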